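(* Let $r\ge1$, let $p_1,\dots,p_r\ge5$ be distinct primes, $P=p_1\cdots p_r$ and $M=6P$. For every positive integer $n$, $$J_M(2n)\le M-\kappa_P(n)+1\le M-2.$$ Moreover, $$J_M(2n)\le 2n-1\quad\Longrightarrow\quad g_P(2n)>0.$$
   Context: $g_P(2n)$ is the number of pairs $(h,k)\in\mathbb Z_{>0}^2$ with $h+k=2n$, $h\le k$, $\gcd(h,M)=\gcd(k,M)=1$. For $q\in\mathbb Z_{>0}$, $x\in\mathbb Z$, $\delta_q(x)=x-q\lfloor x/q\rfloor$. $\mathbf 1_{\{\cdot\}}$ denotes an indicator, $\varepsilon_i(n)=\mathbf 1_{\{\delta_{p_i}(n)=0\}}$, and $$\kappa_P(n)=\bigl(1+\mathbf 1_{\{\delta_3(n)=0\}}\bigr)\prod_{i=1}^r\bigl(p_i-2+\varepsilon_i(n)\bigr).$$ $\widetilde{\mathcal R}_P(n)=\{a\in\mathbb Z:\gcd(a,M)=1,\ \gcd(2n-a,M)=1\}$. The fixed-separation paired gap $J_M(2n)$ is the least positive integer $L$ such that every interval of $L$ consecutive integers contains an element of $\widetilde{\mathcal R}_P(n)$, i.e. such that for every $a\in\mathbb Z$ there exists $h\in\{a+1,\dots,a+L\}$ with $h\in\widetilde{\mathcal R}_P(n)$ (the minimum exists because $\widetilde{\mathcal R}_P(n)$ is nonempty and $M$-periodic). *)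

theory Defs
  imports Complex_Main "HOL-Computational_Algebra.Primes"
begin

text \<open>The primes are given as a family p indexed by 1, ..., r; only these values of p matter.\<close>

definition prod_primes :: "nat \<Rightarrow> (nat \<Rightarrow> nat) \<Rightarrow> nat" where
  "prod_primes r p = (\<Prod>i=1..r. p i)"

definition modulus :: "nat \<Rightarrow> (nat \<Rightarrow> nat) \<Rightarrow> nat" where
  "modulus r p = 6 * prod_primes r p"

definition delta :: "int \<Rightarrow> int \<Rightarrow> int" where
  "delta q x = x - q * \<lfloor>real_of_int x / real_of_int q\<rfloor>"

definition eps :: "(nat \<Rightarrow> nat) \<Rightarrow> nat \<Rightarrow> int \<Rightarrow> int" where
  "eps p i n = of_bool (delta (int (p i)) n = 0)"

definition kappa :: "nat \<Rightarrow> (nat \<Rightarrow> nat) \<Rightarrow> int \<Rightarrow> int" where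
  "kappa r p n = (1 + of_bool (delta 3 n = 0)) * (\<Prod>i=1..r. int (p i) - 2 + eps p i n)"

text \<open>The count is written for a modulus M and a target s; the function \<open>g\<^sub>P(2n)\<close> is obtained
  for \<open>M = 6P\<close> and \<open>s = 2n\<close>.\<close>

definition pair_count :: "nat \<Rightarrow> nat \<Rightarrow> nat" where
  "pair_count M s = card {(h :: nat, k :: nat). 0 < h \<and> 0 < k \<and> h + k = s \<and> h \<le> k
     \<and> gcd h M = 1 \<and> gcd k M = 1}"

text \<open>Likewise, \<open>paired_set M (2 * n)\<close> is the set of all integers a such that both a and
  \<open>2n - a\<close> are prime to M.\<close>

definition paired_set :: "nat \<Rightarrow> int \<Rightarrow> int set" where
  "paired_set M s = {a. gcd a (int M) = 1 \<and> gcd (s - a) (int M) = 1}"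

definition paired_gap :: "nat \<Rightarrow> int \<Rightarrow> nat" where
  "paired_gap M s =
     (LEAST L. 0 < L \<and> (\<forall>a::int. \<exists>h\<in>{a + 1..a + int L}. h \<in> paired_set M s))"

end

theory Submission
  imports Defs "HOL-Number_Theory.Cong"
begin

text \<open>By the Chinese remainder theorem, a period of length \<open>M\<close> contains exactly \<open>\<kappa>\<close>
  elements of the paired set: modulo a prime \<open>q\<close> only the residues \<open>0\<close> and \<open>2n\<close> are excluded,
  and these coincide iff \<open>q\<close> divides \<open>2n\<close>. Among \<open>M - \<kappa> + 1\<close> consecutive integers at least one
  therefore lies in the set, and \<open>\<kappa> \<ge> 3\<close> since some factor \<open>p\<^sub>i - 2\<close> is at least \<open>3\<close>. If the gap is
  at most \<open>2n - 1\<close>, the interval \<open>{1..2n - 1}\<close> contains an element \<open>h\<close> of the set, and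
  \<open>h, 2n - h\<close> in increasing order form an admissible pair.\<close>

lemma delta_eq_mod: "delta q x = x mod q"
  by (simp add: delta_def floor_divide_of_int_eq minus_mult_div_eq_mod)

text \<open>Both gcds see their argument only modulo \<open>M\<close>. This periodicity lets
  residues stand for arbitrary integers, in the Chinese remainder count and in the pigeonhole
  argument.\<close>

lemma paired_set_mod_iff: "a mod int M \<in> paired_set M s \<longleftrightarrow> a \<in> paired_set M s"
proof -
  have "gcd (s - a mod int M) (int M) = gcd ((s - a mod int M) mod int M) (int M)"
    by (metis gcd.commute gcd_red_int)
  also have "\<dots> = gcd ((s - a) mod int M) (int M)"
    by (simp only: mod_diff_right_eq)
  also have "\<dots> = gcd (s - a) (int M)"
    by (metis gcd.commute gcd_red_int)
  finally show ?thesis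
    by (simp add: paired_set_def) (metis gcd.commute gcd_red_int)
qed

lemma paired_set_mult: "paired_set (m * k) s = paired_set m s \<inter> paired_set k s"
  unfolding paired_set_def of_nat_mult coprime_iff_gcd_eq_1[symmetric] coprime_mult_right_iff
  by blast

definition residue_count :: "nat \<Rightarrow> int \<Rightarrow> nat" where
  "residue_count M s = card (paired_set M s \<inter> {0..<int M})"

text \<open>Chinese remainder theorem: reduction modulo both factors is a bijection on one period,
  and being prime to \<open>m * k\<close> means being prime to both \<open>m\<close> and
  \<open>k\<close>.\<close>

lemma residue_count_mult:
  assumes "coprime m k" "m > 0" "k > 0"
  shows "residue_count (m * k) s = residue_count m s * residue_count k s"
proof -
  have cop: "coprime (int m) (int k)"
    using assms by simp
  let ?f = "\<lambda>x. (x mod int m, x mod int k)"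
  have "bij_betw ?f (paired_set (m * k) s \<inter> {0..<int (m * k)})
     ((paired_set m s \<inter> {0..<int m}) \<times> (paired_set k s \<inter> {0..<int k}))"
    unfolding bij_betw_def
  proof
    show "inj_on ?f (paired_set (m * k) s \<inter> {0..<int (m * k)})"
    proof (rule inj_onI)
      fix x y
      assume x: "x \<in> paired_set (m * k) s \<inter> {0..<int (m * k)}"
        and y: "y \<in> paired_set (m * k) s \<inter> {0..<int (m * k)}"
        and "?f x = ?f y"
      then have "[x = y] (mod int m * int k)"
        using cop by (intro coprime_cong_mult) (auto simp: cong_def)
      then show "x = y"
        using x y by (simp add: cong_def)
    qed
    show "?f ` (paired_set (m * k) s \<inter> {0..<int (m * k)})
        = (paired_set m s \<inter> {0..<int m}) \<times> (paired_set k s \<inter> {0..<int k})"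
    proof (intro set_eqI iffI)
      fix z assume "z \<in> ?f ` (paired_set (m * k) s \<inter> {0..<int (m * k)})"
      then show "z \<in> (paired_set m s \<inter> {0..<int m}) \<times> (paired_set k s \<inter> {0..<int k})"
        using assms by (auto simp: paired_set_mult paired_set_mod_iff)
    next
      fix z assume z: "z \<in> (paired_set m s \<inter> {0..<int m}) \<times> (paired_set k s \<inter> {0..<int k})"
      obtain x where x: "[x = fst z] (mod int m)" "[x = snd z] (mod int k)"
        using binary_chinese_remainder_int[OF cop] by blast
      \<comment> \<open>The solution \<open>x\<close> may lie outside the period; reducing it modulo
        \<open>m * k\<close> keeps both residues, since \<open>m\<close> and \<open>k\<close> divide
        \<open>m * k\<close>.\<close>
      define y where "y = x mod int (m * k)"
      have y: "y mod int m = fst z" "y mod int k = snd z"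
        using x z by (auto simp: y_def cong_def mod_mod_cancel)
      have "y \<in> paired_set (m * k) s"
        using z y paired_set_mod_iff[of y m s] paired_set_mod_iff[of y k s]
        by (auto simp: paired_set_mult)
      moreover have "y \<in> {0..<int (m * k)}"
        using assms by (simp add: y_def)
      ultimately show "z \<in> ?f ` (paired_set (m * k) s \<inter> {0..<int (m * k)})"
        using y by (intro image_eqI[of _ _ y]) auto
    qed
  qed
  from bij_betw_same_card[OF this] show ?thesis
    by (simp only: residue_count_def card_cartesian_product)
qed

text \<open>Covering all primes, including 2 and 3, yields the factors of 6 as well: for even
  \<open>s\<close> the prime 2 contributes 2 - 2 + 1 = 1.\<close>

lemma residue_count_prime:
  assumes "prime q"
  shows "int (residue_count q s) = int q - 2 + of_bool (int q dvd s)"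
proof -
  have q: "prime (int q)" "q \<ge> 2"
    using assms prime_ge_2_nat by auto
  have prime_iff: "gcd a (int q) = 1 \<longleftrightarrow> a mod int q \<noteq> 0" for a
    using prime_imp_coprime_int[OF q(1), of a] q(2)
    by (auto simp: coprime_iff_gcd_eq_1 gcd.commute[of a] dvd_eq_mod_eq_0[symmetric]
        gcd_proj1_if_dvd)
  have "a \<in> paired_set q s \<longleftrightarrow> a \<notin> {0, s mod int q}" if "a \<in> {0..<int q}" for a
  proof -
    have "(s - a) mod int q = 0 \<longleftrightarrow> a = s mod int q"
      using that by (auto simp: mod_eq_0_iff_dvd simp flip: mod_eq_dvd_iff)
    moreover have "a mod int q = a"
      using that by simp
    ultimately show ?thesis
      by (simp add: paired_set_def prime_iff)
  qed
  then have eq: "paired_set q s \<inter> {0..<int q} = {0..<int q} - {0, s mod int q}"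
    by blast
  \<comment> \<open>The two excluded residues collapse to one exactly when \<open>q\<close> divides
    \<open>s\<close>.\<close>
  have "card {0, s mod int q} = (if int q dvd s then 1 else 2)"
    by (auto simp: dvd_eq_mod_eq_0)
  moreover have "{0, s mod int q} \<subseteq> {0..<int q}"
    using q(2) by auto
  ultimately show ?thesis
    unfolding residue_count_def eq using q(2)
    by (subst card_Diff_subset) auto
qed

text \<open>Induction on \<open>r\<close> by multiplicativity. The base case is the modulus 6, whose
  count is the leading factor of \<open>kappa\<close>.\<close>

lemma residue_count_modulus:
  assumes "\<And>i. i \<in> {1..r} \<Longrightarrow> prime (p i)"
    and "\<And>i. i \<in> {1..r} \<Longrightarrow> p i \<ge> 5"
    and "inj_on p {1..r}"
  shows "int (residue_count (modulus r p) (2 * n)) = kappa r p n"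
  using assms
proof (induction r)
  case 0
  have "residue_count 6 (2 * n) = residue_count (2 * 3) (2 * n)"
    by simp
  also have "\<dots> = residue_count 2 (2 * n) * residue_count 3 (2 * n)"
    by (rule residue_count_mult) auto
  moreover have "int 3 dvd 2 * n \<longleftrightarrow> 3 dvd n"
    by presburger
  ultimately have "int (residue_count 6 (2 * n)) = 1 + of_bool (3 dvd n)"
    using residue_count_prime[of 2 "2 * n"] residue_count_prime[of 3 "2 * n"] by simp
  then show ?case
    by (simp add: modulus_def prod_primes_def kappa_def delta_eq_mod dvd_eq_mod_eq_0)
next
  case (Suc r)
  let ?q = "p (Suc r)"
  have q: "prime ?q" "?q \<ge> 5"
    using Suc.prems by auto
  have ne: "p i \<noteq> ?q" if "i \<in> {1..r}" for i
    using that inj_onD[OF Suc.prems(3), of i "Suc r"] by auto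
  have "coprime (p i) ?q" if "i \<in> {1..r}" for i
    using that ne Suc.prems(1)[of i] q(1) by (intro primes_coprime) auto
  then have "coprime (prod_primes r p) ?q"
    unfolding prod_primes_def by (rule prod_coprime_left)
  \<comment> \<open>The lower bound 5 keeps the new prime apart from 2 and 3, as injectivity kept it
    apart from the earlier primes.\<close>
  moreover have "coprime (2 * 3) ?q"
    using q primes_coprime[of 2 ?q] primes_coprime[of 3 ?q]
    by (subst coprime_mult_left_iff) auto
  ultimately have "coprime (modulus r p) ?q"
    by (simp add: modulus_def)
  moreover have "modulus r p > 0"
    using Suc.prems(2) by (force simp: modulus_def prod_primes_def intro!: prod_pos)
  moreover have "modulus (Suc r) p = modulus r p * ?q"
    by (simp add: modulus_def prod_primes_def)
  ultimately have count: "residue_count (modulus (Suc r) p) (2 * n)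
      = residue_count (modulus r p) (2 * n) * residue_count ?q (2 * n)"
    using q by (simp add: residue_count_mult)
  have IH: "int (residue_count (modulus r p) (2 * n)) = kappa r p n"
    using Suc.prems by (intro Suc.IH) (auto intro: inj_on_subset)
  \<comment> \<open>The prime is odd, so the criterion for \<open>2 * n\<close> becomes the one for
    \<open>n\<close> in \<open>eps\<close>.\<close>
  have "int ?q dvd 2 * n \<longleftrightarrow> int ?q dvd n"
  proof -
    have "\<not> int ?q dvd 2"
      using q(2) zdvd_imp_le[of "int ?q" 2] by auto
    then show ?thesis
      using q(1) prime_dvd_mult_iff[of "int ?q" 2 n] by simp
  qed
  then have "int (residue_count ?q (2 * n)) = int ?q - 2 + eps p (Suc r) n"
    by (simp add: residue_count_prime[OF q(1)] eps_def delta_eq_mod dvd_eq_mod_eq_0)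
  then show ?case
    by (simp add: count IH kappa_def mult.assoc)
qed

lemma kappa_ge_3:
  assumes "r \<ge> 1" and "\<And>i. i \<in> {1..r} \<Longrightarrow> p i \<ge> 5"
  shows "kappa r p n \<ge> 3"
proof -
  let ?F = "\<lambda>i. int (p i) - 2 + eps p i n"
  have F: "?F i \<ge> 3" if "i \<in> {1..r}" for i
    using assms(2)[OF that] by (simp add: eps_def)
  \<comment> \<open>Index 1 exists because \<open>r \<ge> 1\<close>; the remaining product may be
    empty, so it is bounded below only by 1.\<close>
  have "(\<Prod>i=1..r. ?F i) = ?F 1 * (\<Prod>i\<in>{1..r} - {1}. ?F i)"
    using assms(1) by (intro prod.remove) auto
  moreover have "(\<Prod>i\<in>{1..r} - {1}. ?F i) \<ge> 1"
    using F by (intro prod_ge_1) fastforce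
  ultimately have "(\<Prod>i=1..r. ?F i) \<ge> 3 * 1"
    using F[of 1] assms(1) by (simp only:) (intro mult_mono, auto)
  then show ?thesis
    by (auto simp: kappa_def)
qed

text \<open>Pigeonhole: the integers of the interval have distinct residues, one more than the
  number of residues outside the set.\<close>

lemma paired_set_meets_interval:
  assumes "M > 0" "residue_count M s > 0"
  shows "\<exists>h\<in>{a + 1..a + int (M - residue_count M s + 1)}. h \<in> paired_set M s"
proof (rule ccontr)
  let ?N = "M - residue_count M s + 1"
  let ?I = "{a + 1..a + int ?N}"
  assume none: "\<not> ?thesis"
  have le: "residue_count M s \<le> M"
    using card_mono[of "{0..<int M}" "paired_set M s \<inter> {0..<int M}"]
    by (simp add: residue_count_def)
  have "inj_on (\<lambda>x. x mod int M) ?I"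
  proof (rule inj_onI)
    fix x y assume xy: "x \<in> ?I" "y \<in> ?I" and "x mod int M = y mod int M"
    then have "int M dvd x - y"
      by (simp add: mod_eq_dvd_iff)
    \<comment> \<open>A positive count makes the interval at most \<open>M\<close> long.\<close>
    moreover have "\<bar>x - y\<bar> < int M"
      using xy assms le by auto
    ultimately show "x = y"
      using dvd_imp_le_int[of "x - y" "int M"] by fastforce
  qed
  then have "card ((\<lambda>x. x mod int M) ` ?I) = ?N"
    by (simp add: card_image)
  moreover have "(\<lambda>x. x mod int M) ` ?I \<subseteq> {0..<int M} - paired_set M s"
    using none assms(1) by (auto simp: paired_set_mod_iff)
  then have "card ((\<lambda>x. x mod int M) ` ?I) \<le> card ({0..<int M} - paired_set M s)"
    by (intro card_mono) auto
  moreover have "card ({0..<int M} - paired_set M s) = M - residue_count M s"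
    by (simp add: card_Diff_subset_Int residue_count_def Int_commute)
  ultimately show False
    by simp
qed

text \<open>The pigeonhole length is a witness for the \<open>LEAST\<close> in
  \<open>paired_gap\<close>; it therefore bounds the minimum and shows that the minimum has the
  defining property.\<close>

lemma
  assumes "M > 0" "residue_count M s > 0"
  shows paired_gap_le: "paired_gap M s \<le> M - residue_count M s + 1"
    and paired_gap_spec: "\<exists>h\<in>{a + 1..a + int (paired_gap M s)}. h \<in> paired_set M s"
proof -
  let ?P = "\<lambda>L. 0 < L \<and> (\<forall>a::int. \<exists>h\<in>{a + 1..a + int L}. h \<in> paired_set M s)"
  have P: "?P (M - residue_count M s + 1)"
    using paired_set_meets_interval[OF assms] by simp
  then show "paired_gap M s \<le> M - residue_count M s + 1"
    unfolding paired_gap_def by (rule Least_le)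
  have "?P (paired_gap M s)"
    unfolding paired_gap_def by (rule LeastI[of ?P, OF P])
  then show "\<exists>h\<in>{a + 1..a + int (paired_gap M s)}. h \<in> paired_set M s"
    by blast
qed

lemma pair_count_pos:
  assumes "h \<in> paired_set M (int s)" "0 < h" "h < int s"
  shows "pair_count M s > 0"
proof -
  let ?S = "{(h :: nat, k :: nat). 0 < h \<and> 0 < k \<and> h + k = s \<and> h \<le> k
     \<and> gcd h M = 1 \<and> gcd k M = 1}"
  define x y where "x = nat h" and "y = nat (int s - h)"
  have int_xy: "int x = h" "int y = int s - h"
    using assms by (auto simp: x_def y_def)
  have "int (gcd x M) = 1" "int (gcd y M) = 1"
    using assms(1) by (simp_all add: paired_set_def int_xy flip: gcd_int_int_eq)
  then have "gcd x M = 1" "gcd y M = 1"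
    by linarith+
  \<comment> \<open>Sorting the two summands secures the required order
    \<open>h \<le> k\<close>.\<close>
  then have mem: "(min x y, max x y) \<in> ?S"
    using assms int_xy by (auto simp: min_def max_def)
  \<comment> \<open>An infinite set would have \<open>card\<close> equal to 0, so a member alone
    does not give positivity.\<close>
  have fin: "finite ?S"
    by (rule finite_subset[of _ "{..s} \<times> {..s}"]) auto
  have "card A > 0" if "a \<in> A" "finite A" for a :: "nat \<times> nat" and A
    using that by (auto simp: card_gt_0_iff)
  from this[OF mem fin] show ?thesis
    by (simp only: pair_count_def)
qed

theorem proposition5p7:
  fixes r n :: nat and p :: "nat \<Rightarrow> nat"
  assumes "r \<ge> 1"
    and "\<And>i. i \<in> {1..r} \<Longrightarrow> prime (p i)"
    and "\<And>i. i \<in> {1..r} \<Longrightarrow> p i \<ge> 5"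
    and "inj_on p {1..r}"
    and "n > 0"
  shows "int (paired_gap (modulus r p) (2 * int n)) \<le> int (modulus r p) - kappa r p (int n) + 1
    \<and> int (modulus r p) - kappa r p (int n) + 1 \<le> int (modulus r p) - 2
    \<and> (int (paired_gap (modulus r p) (2 * int n)) \<le> 2 * int n - 1
      \<longrightarrow> pair_count (modulus r p) (2 * n) > 0)"
proof (intro conjI impI)
  let ?M = "modulus r p" and ?s = "2 * int n"
  have count: "int (residue_count ?M ?s) = kappa r p (int n)"
    using assms by (intro residue_count_modulus) auto
  have kappa: "kappa r p (int n) \<ge> 3"
    using assms by (intro kappa_ge_3) auto
  have M: "?M > 0"
    using assms(3) by (force simp: modulus_def prod_primes_def intro!: prod_pos)
  have pos: "residue_count ?M ?s > 0"
    using count kappa by linarith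
  \<comment> \<open>Ensures that the truncated subtraction on naturals in
    \<open>paired_gap_le\<close> agrees with integer subtraction.\<close>
  have "residue_count ?M ?s \<le> ?M"
    using card_mono[of "{0..<int ?M}" "paired_set ?M ?s \<inter> {0..<int ?M}"]
    by (simp add: residue_count_def)
  then show "int (paired_gap ?M ?s) \<le> int ?M - kappa r p (int n) + 1"
    using paired_gap_le[OF M pos] count by linarith
  show "int ?M - kappa r p (int n) + 1 \<le> int ?M - 2"
    using kappa by linarith
  assume "int (paired_gap ?M ?s) \<le> 2 * int n - 1"
  \<comment> \<open>Starting at 0 gives \<open>h \<ge> 1\<close>, and the gap bound gives
    \<open>h \<le> 2 * int n - 1\<close>, so both summands are positive.\<close>
  moreover obtain h where "h \<in> {0 + 1..0 + int (paired_gap ?M ?s)}" "h \<in> paired_set ?M ?s"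
    using paired_gap_spec[OF M pos] by blast
  ultimately show "pair_count ?M (2 * n) > 0"
    by (intro pair_count_pos[of h]) auto
qed

end
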